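(* The generic type of a quasiminimal structure is locally strongly regular via $x=x$. That is, if $M$ is a quasiminimal structure and $p(x)\in S_1(M)$ is its generic type, then $p$ is non-isolated and, for every finite tuple $\bar b$ from a saturated elementary extension $\bar M$ of $M$ such that no element of $\bar b$ realizes $p$, the type $p$ has a unique extension to a complete type over $M\bar b$.
   Context: Quasiminimal: $M$ is an uncountable one-sorted structure in a countable language such that every subset of $M$ definable with parameters is countable or co-countable. The generic type $p(x)\in S_1(M)$ consists of all formulas with parameters in $M$ defining a co-countable subset of $M$. A non-isolated type $p(x)\in S_1(A)$ is locally strongly regular via $\phi(x)\in p(x)$ if $p(x)$ has a unique complete extension over $A\bar b$ whenever $\bar b\in\bar M$ is a finite tuple of realizations of $\phi(x)$ no element of which realizes $p$. *)

theory Defs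
  imports Main "HOL-Library.Countable_Set" "HOL-Library.Equipollence"
begin

record ('f, 'r) language =
  funs :: "'f set"
  rels :: "'r set"
  farity :: "'f \<Rightarrow> nat"
  rarity :: "'r \<Rightarrow> nat"

record ('f, 'r, 'a) fo_structure =
  univ :: "'a set"
  fint :: "'f \<Rightarrow> 'a list \<Rightarrow> 'a"
  rint :: "'r \<Rightarrow> 'a list \<Rightarrow> bool"

text \<open>Formulas may contain elements of a structure as parameters: \<open>Param a\<close> plays the role of
  a new constant symbol naming \<open>a\<close>.  Formulas of the bare language are those with parameters
  from the empty set.\<close>

datatype ('f, 'a) fo_term =
    Var nat
  | Param 'a
  | App 'f "('f, 'a) fo_term list"

datatype ('f, 'r, 'a) fo_formula =
    Equal "('f, 'a) fo_term" "('f, 'a) fo_term"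
  | Rel 'r "('f, 'a) fo_term list"
  | Neg "('f, 'r, 'a) fo_formula"
  | Conj "('f, 'r, 'a) fo_formula" "('f, 'r, 'a) fo_formula"
  | Ex nat "('f, 'r, 'a) fo_formula"

fun wf_term :: "('f, 'r) language \<Rightarrow> 'a set \<Rightarrow> ('f, 'a) fo_term \<Rightarrow> bool" where
  "wf_term L A (Var n) = True"
| "wf_term L A (Param a) = (a \<in> A)"
| "wf_term L A (App f ts) =
    (f \<in> funs L \<and> length ts = farity L f \<and> (\<forall>t\<in>set ts. wf_term L A t))"

fun wf_formula :: "('f, 'r) language \<Rightarrow> 'a set \<Rightarrow> ('f, 'r, 'a) fo_formula \<Rightarrow> bool" where
  "wf_formula L A (Equal s t) = (wf_term L A s \<and> wf_term L A t)"
| "wf_formula L A (Rel r ts) =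
    (r \<in> rels L \<and> length ts = rarity L r \<and> (\<forall>t\<in>set ts. wf_term L A t))"
| "wf_formula L A (Neg \<phi>) = wf_formula L A \<phi>"
| "wf_formula L A (Conj \<phi> \<psi>) = (wf_formula L A \<phi> \<and> wf_formula L A \<psi>)"
| "wf_formula L A (Ex n \<phi>) = wf_formula L A \<phi>"

fun fv_term :: "('f, 'a) fo_term \<Rightarrow> nat set" where
  "fv_term (Var n) = {n}"
| "fv_term (Param a) = {}"
| "fv_term (App f ts) = (\<Union>t\<in>set ts. fv_term t)"

fun fv :: "('f, 'r, 'a) fo_formula \<Rightarrow> nat set" where
  "fv (Equal s t) = fv_term s \<union> fv_term t"
| "fv (Rel r ts) = (\<Union>t\<in>set ts. fv_term t)"
| "fv (Neg \<phi>) = fv \<phi>"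
| "fv (Conj \<phi> \<psi>) = fv \<phi> \<union> fv \<psi>"
| "fv (Ex n \<phi>) = fv \<phi> - {n}"

fun eval_term :: "('f, 'r, 'a) fo_structure \<Rightarrow> (nat \<Rightarrow> 'a) \<Rightarrow> ('f, 'a) fo_term \<Rightarrow> 'a" where
  "eval_term M v (Var n) = v n"
| "eval_term M v (Param a) = a"
| "eval_term M v (App f ts) = fint M f (map (eval_term M v) ts)"

fun sat :: "('f, 'r, 'a) fo_structure \<Rightarrow> (nat \<Rightarrow> 'a) \<Rightarrow> ('f, 'r, 'a) fo_formula \<Rightarrow> bool" where
  "sat M v (Equal s t) = (eval_term M v s = eval_term M v t)"
| "sat M v (Rel r ts) = rint M r (map (eval_term M v) ts)"
| "sat M v (Neg \<phi>) = (\<not> sat M v \<phi>)"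
| "sat M v (Conj \<phi> \<psi>) = (sat M v \<phi> \<and> sat M v \<psi>)"
| "sat M v (Ex n \<phi>) = (\<exists>a\<in>univ M. sat M (v(n := a)) \<phi>)"

definition is_structure :: "('f, 'r) language \<Rightarrow> ('f, 'r, 'a) fo_structure \<Rightarrow> bool" where
  "is_structure L M \<longleftrightarrow> univ M \<noteq> {} \<and>
    (\<forall>f\<in>funs L. \<forall>xs. set xs \<subseteq> univ M \<longrightarrow> length xs = farity L f \<longrightarrow> fint M f xs \<in> univ M)"

definition countable_language :: "('f, 'r) language \<Rightarrow> bool" where
  "countable_language L \<longleftrightarrow> countable (funs L) \<and> countable (rels L)"

definition substructure ::
  "('f, 'r) language \<Rightarrow> ('f, 'r, 'a) fo_structure \<Rightarrow> ('f, 'r, 'a) fo_structure \<Rightarrow> bool" where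
  "substructure L M N \<longleftrightarrow> is_structure L M \<and> is_structure L N \<and> univ M \<subseteq> univ N \<and>
    (\<forall>f\<in>funs L. \<forall>xs. set xs \<subseteq> univ M \<longrightarrow> length xs = farity L f \<longrightarrow> fint M f xs = fint N f xs) \<and>
    (\<forall>r\<in>rels L. \<forall>xs. set xs \<subseteq> univ M \<longrightarrow> length xs = rarity L r \<longrightarrow> rint M r xs = rint N r xs)"

definition elementary_extension ::
  "('f, 'r) language \<Rightarrow> ('f, 'r, 'a) fo_structure \<Rightarrow> ('f, 'r, 'a) fo_structure \<Rightarrow> bool" where
  "elementary_extension L M N \<longleftrightarrow> substructure L M N \<and>
    (\<forall>\<phi> v. wf_formula L {} \<phi> \<longrightarrow> range v \<subseteq> univ M \<longrightarrow> (sat M v \<phi> \<longleftrightarrow> sat N v \<phi>))"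

text \<open>The variable \<open>x\<close> of a 1-type is \<open>Var 0\<close>.\<close>

definition formulas1 :: "('f, 'r) language \<Rightarrow> 'a set \<Rightarrow> ('f, 'r, 'a) fo_formula set" where
  "formulas1 L A = {\<phi>. wf_formula L A \<phi> \<and> fv \<phi> \<subseteq> {0}}"

text \<open>Used for \<open>\<phi> \<in> formulas1 L A\<close> only, so that just the value of \<open>Var 0\<close> matters and
  the constant valuation is harmless.\<close>

definition holds_at :: "('f, 'r, 'a) fo_structure \<Rightarrow> ('f, 'r, 'a) fo_formula \<Rightarrow> 'a \<Rightarrow> bool" where
  "holds_at M \<phi> a \<longleftrightarrow> sat M (\<lambda>_. a) \<phi>"

definition defset :: "('f, 'r, 'a) fo_structure \<Rightarrow> ('f, 'r, 'a) fo_formula \<Rightarrow> 'a set" where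
  "defset M \<phi> = {a \<in> univ M. holds_at M \<phi> a}"

definition quasiminimal :: "('f, 'r) language \<Rightarrow> ('f, 'r, 'a) fo_structure \<Rightarrow> bool" where
  "quasiminimal L M \<longleftrightarrow> countable_language L \<and> is_structure L M \<and> uncountable (univ M) \<and>
    (\<forall>\<phi>\<in>formulas1 L (univ M). countable (defset M \<phi>) \<or> countable (univ M - defset M \<phi>))"

definition generic_type ::
  "('f, 'r) language \<Rightarrow> ('f, 'r, 'a) fo_structure \<Rightarrow> ('f, 'r, 'a) fo_formula set" where
  "generic_type L M = {\<phi> \<in> formulas1 L (univ M). countable (univ M - defset M \<phi>)}"

text \<open>\<open>complete_types L N A\<close> is the space \<open>S\<^sub>1(A)\<close> computed in \<open>N\<close>, for \<open>A \<subseteq> univ N\<close>.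
  Consistency with the theory of \<open>N\<close> with names for \<open>A\<close> is finite satisfiability in \<open>N\<close>.\<close>

definition complete_types ::
  "('f, 'r) language \<Rightarrow> ('f, 'r, 'a) fo_structure \<Rightarrow> 'a set \<Rightarrow> ('f, 'r, 'a) fo_formula set set" where
  "complete_types L N A = {p. p \<subseteq> formulas1 L A \<and>
    (\<forall>F. finite F \<longrightarrow> F \<subseteq> p \<longrightarrow> (\<exists>a\<in>univ N. \<forall>\<phi>\<in>F. holds_at N \<phi> a)) \<and>
    (\<forall>\<phi>\<in>formulas1 L A. \<phi> \<in> p \<or> Neg \<phi> \<in> p)}"

definition realizes ::
  "('f, 'r, 'a) fo_structure \<Rightarrow> 'a \<Rightarrow> ('f, 'r, 'a) fo_formula set \<Rightarrow> bool" where
  "realizes N a p \<longleftrightarrow> a \<in> univ N \<and> (\<forall>\<phi>\<in>p. holds_at N \<phi> a)"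

definition isolated_type ::
  "('f, 'r) language \<Rightarrow> ('f, 'r, 'a) fo_structure \<Rightarrow> 'a set \<Rightarrow> ('f, 'r, 'a) fo_formula set \<Rightarrow> bool" where
  "isolated_type L N A p \<longleftrightarrow> (\<exists>\<phi>\<in>formulas1 L A. {q \<in> complete_types L N A. \<phi> \<in> q} = {p})"

definition saturated :: "('f, 'r) language \<Rightarrow> ('f, 'r, 'a) fo_structure \<Rightarrow> bool" where
  "saturated L N \<longleftrightarrow> is_structure L N \<and>
    (\<forall>A p. A \<subseteq> univ N \<longrightarrow> A \<prec> univ N \<longrightarrow> p \<in> complete_types L N A \<longrightarrow> (\<exists>a. realizes N a p))"

definition locally_strongly_regular ::
  "('f, 'r) language \<Rightarrow> ('f, 'r, 'a) fo_structure \<Rightarrow> 'a set \<Rightarrow> ('f, 'r, 'a) fo_formula set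
    \<Rightarrow> ('f, 'r, 'a) fo_formula \<Rightarrow> bool" where
  "locally_strongly_regular L N A p \<phi> \<longleftrightarrow>
    p \<in> complete_types L N A \<and> \<not> isolated_type L N A p \<and> \<phi> \<in> p \<and>
    (\<forall>bs. set bs \<subseteq> univ N \<longrightarrow> (\<forall>b\<in>set bs. holds_at N \<phi> b \<and> \<not> realizes N b p) \<longrightarrow>
      (\<exists>!q. q \<in> complete_types L N (A \<union> set bs) \<and> p \<subseteq> q))"

end

theory Submission
  imports Defs
begin

text \<open>Let \<open>b\<close> be a tuple no element of which realizes the generic type \<open>p\<close>.  Then \<open>b\<close>
  satisfies some formula \<open>\<psi>(y)\<close> over \<open>M\<close> with only countably many solutions in \<open>M\<close>.  For every
  \<open>\<phi>(x, y)\<close> and every solution \<open>y\<close> of \<open>\<psi>\<close> in \<open>M\<close>, discard the countable one of \<open>\<phi>(M, y)\<close> and its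
  complement; this discards only countably many \<open>x\<close>.  Fix \<open>x\<^sub>0\<close> among the remaining ones.  The formula
  \<open>\<theta>(x)\<close> saying \<open>\<forall>y. \<psi>(y) \<longrightarrow> (\<phi>(x, y) \<longleftrightarrow> \<phi>(x\<^sub>0, y))\<close> then holds at all of them, so it is in \<open>p\<close>,
  and in \<open>N\<close> it decides \<open>\<phi>(x, b)\<close>.\<close>

section \<open>Parameters and variables\<close>

text \<open>Parameters in the domain of \<open>i\<close> become odd-numbered variables; the original variables are
  moved to the even numbers, which avoids any capture.\<close>

fun abs_term :: "('a \<Rightarrow> nat option) \<Rightarrow> ('f, 'a) fo_term \<Rightarrow> ('f, 'a) fo_term" where
  "abs_term i (Var n) = Var (2 * n)"
| "abs_term i (Param a) = (case i a of None \<Rightarrow> Param a | Some k \<Rightarrow> Var (2 * k + 1))"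
| "abs_term i (App f ts) = App f (map (abs_term i) ts)"

fun abs_formula :: "('a \<Rightarrow> nat option) \<Rightarrow> ('f, 'r, 'a) fo_formula \<Rightarrow> ('f, 'r, 'a) fo_formula" where
  "abs_formula i (Equal s t) = Equal (abs_term i s) (abs_term i t)"
| "abs_formula i (Rel r ts) = Rel r (map (abs_term i) ts)"
| "abs_formula i (Neg \<phi>) = Neg (abs_formula i \<phi>)"
| "abs_formula i (Conj \<phi> \<psi>) = Conj (abs_formula i \<phi>) (abs_formula i \<psi>)"
| "abs_formula i (Ex n \<phi>) = Ex (2 * n) (abs_formula i \<phi>)"

text \<open>Under a valuation \<open>w\<close>, an abstracted formula behaves like the original one
  with its parameters replaced along this map. So varying the odd entries of \<open>w\<close> lets a
  single formula speak about all tuples.\<close>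

definition abs_inst :: "('a \<Rightarrow> nat option) \<Rightarrow> (nat \<Rightarrow> 'a) \<Rightarrow> 'a \<Rightarrow> 'a" where
  "abs_inst i w a = (case i a of None \<Rightarrow> a | Some k \<Rightarrow> w (2 * k + 1))"

abbreviation map_params :: "('a \<Rightarrow> 'a) \<Rightarrow> ('f, 'r, 'a) fo_formula \<Rightarrow> ('f, 'r, 'a) fo_formula" where
  "map_params h \<equiv> map_fo_formula (\<lambda>f. f) (\<lambda>r. r) h"

lemma eval_abs_term:
  "eval_term K w (abs_term i t) =
    eval_term K (\<lambda>n. w (2 * n)) (map_fo_term (\<lambda>f. f) (abs_inst i w) t)"
proof (induction t)
  case (App f ts)
  then have "map (eval_term K w \<circ> abs_term i) ts
      = map (eval_term K (\<lambda>n. w (2 * n)) \<circ> map_fo_term (\<lambda>f. f) (abs_inst i w)) ts"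
    by simp
  then show ?case by (simp only: abs_term.simps fo_term.map eval_term.simps list.map_comp)
qed (auto simp: abs_inst_def split: option.split)

text \<open>Quantifiers of an abstracted formula bind even variables only. Rebinding one of them
  therefore leaves the parameter values, which are stored at odd indices, unchanged.\<close>

lemma sat_abs_formula:
  "sat K w (abs_formula i \<phi>) \<longleftrightarrow>
    sat K (\<lambda>n. w (2 * n)) (map_params (abs_inst i w) \<phi>)"
proof (induction \<phi> arbitrary: w)
  case (Ex n \<phi>)
  have "abs_inst i (w(2 * n := a)) = abs_inst i w" for a
    unfolding abs_inst_def fun_eq_iff by (auto split: option.split) presburger
  moreover have "(\<lambda>m. (w(2 * n := a)) (2 * m)) = (\<lambda>m. w (2 * m))(n := a)" for a
    by auto
  ultimately show ?case
    by (simp only: abs_formula.simps sat.simps fo_formula.map Ex.IH)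
qed (simp_all add: eval_abs_term comp_def)

lemma wf_abs_term: "wf_term L A (abs_term i t) \<longleftrightarrow> wf_term L (A \<union> dom i) t"
  by (induction t) (auto split: option.split)

lemma wf_abs_formula: "wf_formula L A (abs_formula i \<phi>) \<longleftrightarrow> wf_formula L (A \<union> dom i) \<phi>"
  by (induction \<phi>) (auto simp: wf_abs_term)

lemma fv_abs_term: "fv_term (abs_term i t) \<subseteq> (\<lambda>n. 2 * n) ` fv_term t \<union> (\<lambda>k. 2 * k + 1) ` ran i"
proof (induction t)
  case (Param a)
  show ?case by (cases "i a") (auto intro: ranI)
next
  case (App f ts)
  then show ?case by (simp add: UN_subset_iff) blast
qed auto

lemma fv_abs_formula: "fv (abs_formula i \<phi>) \<subseteq> (\<lambda>n. 2 * n) ` fv \<phi> \<union> (\<lambda>k. 2 * k + 1) ` ran i"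
proof (induction \<phi>)
  case (Equal s t)
  show ?case using fv_abs_term[of i s] fv_abs_term[of i t] by auto
next
  case (Rel r ts)
  have "fv_term (abs_term i t) \<subseteq>
      (\<lambda>n. 2 * n) ` (\<Union>t\<in>set ts. fv_term t) \<union> (\<lambda>k. 2 * k + 1) ` ran i" if "t \<in> set ts" for t
    using fv_abs_term[of i t] that by blast
  then show ?case by (simp add: UN_subset_iff)
next
  case (Ex n \<phi>)
  then show ?case by auto
next
  case (Conj \<phi> \<psi>)
  then show ?case by (simp add: image_Un) blast
qed simp

section \<open>Replacing parameters, and the finite set of parameters of a formula\<close>

lemma wf_map_term: "wf_term L A (map_fo_term (\<lambda>f. f) h t) \<longleftrightarrow> wf_term L (h -` A) t"
  by (induction t) auto

lemma wf_map_params: "wf_formula L A (map_params h \<phi>) \<longleftrightarrow> wf_formula L (h -` A) \<phi>"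
  by (induction \<phi>) (auto simp: wf_map_term)

lemma fv_map_term: "fv_term (map_fo_term (\<lambda>f. f) h t) = fv_term t"
  by (induction t) auto

lemma fv_map_params: "fv (map_params h \<phi>) = fv \<phi>"
  by (induction \<phi>) (auto simp: fv_map_term)

lemma wf_term_params: "wf_term L A t \<longleftrightarrow> wf_term L UNIV t \<and> set2_fo_term t \<subseteq> A"
  by (induction t) auto

lemma wf_formula_params:
  "wf_formula L A \<phi> \<longleftrightarrow> wf_formula L UNIV \<phi> \<and> set3_fo_formula \<phi> \<subseteq> A"
proof (induction \<phi>)
  case (Equal s t)
  show ?case using wf_term_params[of L A s] wf_term_params[of L A t] by auto
next
  case (Rel r ts)
  show ?case using wf_term_params[of L A] by auto
qed auto

lemma finite_params_term: "finite (set2_fo_term t)"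
  by (induction t) auto

lemma finite_params: "finite (set3_fo_formula \<phi>)"
  by (induction \<phi>) (auto simp: finite_params_term)

lemma wf_formula_mono: "wf_formula L A \<phi> \<Longrightarrow> A \<subseteq> B \<Longrightarrow> wf_formula L B \<phi>"
  using wf_formula_params[of L A \<phi>] wf_formula_params[of L B \<phi>] by auto

lemma formulas1_mono: "A \<subseteq> B \<Longrightarrow> formulas1 L A \<subseteq> formulas1 L B"
  by (auto simp: formulas1_def intro: wf_formula_mono)

lemma formulas1_Neg: "\<phi> \<in> formulas1 L A \<Longrightarrow> Neg \<phi> \<in> formulas1 L A"
  by (simp add: formulas1_def)

lemma map_params_idI:
  assumes "\<And>a. a \<in> set3_fo_formula \<phi> \<Longrightarrow> h a = a"
  shows "map_params h \<phi> = \<phi>"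
proof -
  have "map_params h \<phi> = map_params id \<phi>"
    using assms by (intro fo_formula.map_cong) auto
  then show ?thesis by (simp add: fo_formula.map_ident id_def)
qed

section \<open>Dependence on free variables, and elementarity for formulas with parameters\<close>

lemma eval_term_cong: "(\<And>n. n \<in> fv_term t \<Longrightarrow> v n = w n) \<Longrightarrow> eval_term K v t = eval_term K w t"
proof (induction t)
  case (App f ts)
  then have "map (eval_term K v) ts = map (eval_term K w) ts" by auto
  then show ?case by (simp only: eval_term.simps)
qed auto

lemma sat_cong: "(\<And>n. n \<in> fv \<phi> \<Longrightarrow> v n = w n) \<Longrightarrow> sat K v \<phi> \<longleftrightarrow> sat K w \<phi>"
proof (induction \<phi> arbitrary: v w)
  case (Equal s t)
  then show ?case using eval_term_cong[of s v w K] eval_term_cong[of t v w K] by auto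
next
  case (Rel r ts)
  then have "map (eval_term K v) ts = map (eval_term K w) ts"
    by (auto intro!: eval_term_cong)
  then show ?case by (simp only: sat.simps)
next
  case (Neg \<phi>)
  have "sat K v \<phi> \<longleftrightarrow> sat K w \<phi>" using Neg.prems by (intro Neg.IH) simp
  then show ?case by simp
next
  case (Conj \<phi> \<psi>)
  have "sat K v \<phi> \<longleftrightarrow> sat K w \<phi>" using Conj.prems by (intro Conj.IH(1)) simp
  moreover have "sat K v \<psi> \<longleftrightarrow> sat K w \<psi>" using Conj.prems by (intro Conj.IH(2)) simp
  ultimately show ?case by simp
next
  case (Ex n \<phi>)
  have "sat K (v(n := a)) \<phi> \<longleftrightarrow> sat K (w(n := a)) \<phi>" for a
    using Ex.prems by (intro Ex.IH) auto
  then show ?case by simp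
qed

lemma sat_formulas1: "\<phi> \<in> formulas1 L A \<Longrightarrow> sat K v \<phi> \<longleftrightarrow> holds_at K \<phi> (v 0)"
  unfolding holds_at_def formulas1_def by (rule sat_cong) auto

text \<open>Elementarity is defined for formulas without parameters. The finitely many parameters in
  \<open>\<phi>\<close> are turned into variables, and the valuation supplies their values
  again.\<close>

lemma elementary_extension_sat:
  assumes "elementary_extension L M N" "wf_formula L (univ M) \<phi>" "range v \<subseteq> univ M"
  shows "sat M v \<phi> \<longleftrightarrow> sat N v \<phi>"
proof -
  \<comment> \<open>Inserting \<open>v 0\<close> keeps \<open>P\<close> nonempty, so that
    \<open>from_nat_into P\<close> takes values in \<open>P\<close> at every index.\<close>
  define P where "P = insert (v 0) (set3_fo_formula \<phi>)"
  have P: "countable P" "P \<noteq> {}" "P \<subseteq> univ M"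
    using assms(3) wf_formula_params[of L "univ M" \<phi>] assms(2)
    by (auto simp: P_def finite_params intro: countable_finite)
  define i where "i a = (if a \<in> P then Some (to_nat_on P a) else None)" for a
  \<comment> \<open>The even entries carry \<open>v\<close>. The entry at \<open>2 * k + 1\<close>
    is the element of \<open>P\<close> with code \<open>k\<close>, so abstracting and then
    instantiating gives back \<open>\<phi>\<close>.\<close>
  define w where "w n = (if even n then v (n div 2) else from_nat_into P (n div 2))" for n
  have "range w \<subseteq> univ M"
    using assms(3) P from_nat_into[OF P(2)] by (auto simp: w_def)
  moreover have "wf_formula L {} (abs_formula i \<phi>)"
    using assms(2) wf_formula_params[of L "univ M" \<phi>] wf_formula_params[of L "{} \<union> dom i" \<phi>]
    by (auto simp: wf_abs_formula i_def P_def dom_def)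
  ultimately have "sat M w (abs_formula i \<phi>) \<longleftrightarrow> sat N w (abs_formula i \<phi>)"
    using assms(1) by (auto simp: elementary_extension_def)
  moreover have "map_params (abs_inst i w) \<phi> = \<phi>"
    using P(1) by (intro map_params_idI) (auto simp: abs_inst_def i_def w_def P_def)
  moreover have "(\<lambda>n. w (2 * n)) = v" by (auto simp: w_def)
  ultimately show ?thesis by (simp add: sat_abs_formula)
qed

lemma elementary_extension_holds_at:
  assumes "elementary_extension L M N" "\<phi> \<in> formulas1 L (univ M)" "a \<in> univ M"
  shows "holds_at M \<phi> a \<longleftrightarrow> holds_at N \<phi> a"
  using elementary_extension_sat[OF assms(1), of \<phi> "\<lambda>_. a"] assms(2,3)
  by (auto simp: holds_at_def formulas1_def)

section \<open>Formulas agreeing with a fixed element\<close>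

lemma sat_foldr_Ex:
  "sat K w (foldr Ex ns \<phi>) \<longleftrightarrow>
    (\<exists>w'. (\<forall>n. n \<notin> set ns \<longrightarrow> w' n = w n) \<and> (\<forall>n\<in>set ns. w' n \<in> univ K) \<and> sat K w' \<phi>)"
proof (induction ns arbitrary: w)
  case Nil
  have "w' = w" if "\<forall>n. w' n = w n" for w' using that by auto
  then show ?case by auto
next
  case (Cons m ns)
  show ?case (is "?L \<longleftrightarrow> ?R")
  proof
    assume ?L
    then obtain a w' where "a \<in> univ K" and w': "\<forall>n. n \<notin> set ns \<longrightarrow> w' n = (w(m := a)) n"
        "\<forall>n\<in>set ns. w' n \<in> univ K" "sat K w' \<phi>"
      by (auto simp: Cons.IH)
    \<comment> \<open>If \<open>m\<close> recurs in \<open>ns\<close>, an inner quantifier rebinds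
      it and its final value need not be \<open>a\<close>; it lies in the universe in either
      case.\<close>
    moreover have "w' m \<in> univ K"
      using w' \<open>a \<in> univ K\<close> by (cases "m \<in> set ns") auto
    ultimately show ?R by (intro exI[of _ w']) auto
  next
    assume ?R
    then obtain w' where w': "\<forall>n. n \<notin> set (m # ns) \<longrightarrow> w' n = w n"
        "\<forall>n\<in>set (m # ns). w' n \<in> univ K" "sat K w' \<phi>"
      by blast
    then have "sat K (w(m := w' m)) (foldr Ex ns \<phi>)"
      unfolding Cons.IH by (intro exI[of _ w']) auto
    then show ?L using w' by auto
  qed
qed

lemma wf_foldr_Ex: "wf_formula L A (foldr Ex ns \<phi>) \<longleftrightarrow> wf_formula L A \<phi>"
  by (induction ns) auto

lemma fv_foldr_Ex: "fv (foldr Ex ns \<phi>) = fv \<phi> - set ns"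
  by (induction ns) auto

lemma sat_foldr_Conj: "sat K w (foldr Conj \<phi>s \<phi>) \<longleftrightarrow> (\<forall>\<psi>\<in>set \<phi>s. sat K w \<psi>) \<and> sat K w \<phi>"
  by (induction \<phi>s) auto

lemma wf_foldr_Conj:
  "wf_formula L A (foldr Conj \<phi>s \<phi>) \<longleftrightarrow> (\<forall>\<psi>\<in>set \<phi>s. wf_formula L A \<psi>) \<and> wf_formula L A \<phi>"
  by (induction \<phi>s) auto

lemma fv_foldr_Conj: "fv (foldr Conj \<phi>s \<phi>) = (\<Union>\<psi>\<in>set \<phi>s. fv \<psi>) \<union> fv \<phi>"
  by (induction \<phi>s) auto

text \<open>An assignment \<open>h\<close> of values to the parameters in \<open>B\<close> plays the role of the tuple \<open>y\<close>.\<close>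

definition admissible ::
  "('f, 'r, 'a) fo_structure \<Rightarrow> 'a set \<Rightarrow> ('a \<Rightarrow> ('f, 'r, 'a) fo_formula) \<Rightarrow> ('a \<Rightarrow> 'a) \<Rightarrow> bool" where
  "admissible K B \<psi> h \<longleftrightarrow> (\<forall>a. a \<notin> B \<longrightarrow> h a = a) \<and> (\<forall>b\<in>B. h b \<in> defset K (\<psi> b))"

text \<open>The formula denies that some tuple satisfying the conditions \<open>\<psi>\<close>
  separates \<open>x\<close> from \<open>x\<^sub>0\<close>. It is fixed before \<open>K\<close>, so
  the same formula can be read both in \<open>M\<close> and in its extension.\<close>

lemma agreement_formula:
  fixes \<phi> :: "('f, 'r, 'a) fo_formula"
  assumes \<phi>: "\<phi> \<in> formulas1 L (A \<union> B)" and "finite B"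
    and \<psi>: "\<And>b. b \<in> B \<Longrightarrow> \<psi> b \<in> formulas1 L A" and "x\<^sub>0 \<in> A"
  obtains \<theta> where "\<theta> \<in> formulas1 L A"
    and "\<And>K x. A \<subseteq> univ K \<Longrightarrow> x \<in> univ K \<Longrightarrow> holds_at K \<theta> x \<longleftrightarrow>
      (\<forall>h. admissible K B \<psi> h \<longrightarrow>
        (holds_at K (map_params h \<phi>) x \<longleftrightarrow> holds_at K (map_params h \<phi>) x\<^sub>0))"
proof -
  obtain bs where bs: "set bs = B" using finite_list[OF \<open>finite B\<close>] by blast
  define i where "i a = (if a \<in> B then Some (to_nat_on B a) else None)" for a
  \<comment> \<open>All these variables are odd, hence different from variable 0, which still stands
    for \<open>x\<close> after abstraction.\<close>
  define y where "y b = 2 * to_nat_on B b + 1" for b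
  have y_inj: "y b = y c \<Longrightarrow> b \<in> B \<Longrightarrow> c \<in> B \<Longrightarrow> b = c" for b c
    using to_nat_on_inj[of B b c] \<open>finite B\<close> by (auto simp: y_def countable_finite)
  define \<phi>' where "\<phi>' = abs_formula i \<phi>"
  \<comment> \<open>Substitution for variable 0 is expressed by quantifying over it and adding an
    equation: here \<open>x\<^sub>0\<close> is put in for \<open>x\<close>, and in
    \<open>\<psi>'\<close> the variable \<open>y b\<close> is. Then \<open>\<chi>\<close> says that
    \<open>\<phi>\<close> has different truth values at \<open>x\<close> and
    \<open>x\<^sub>0\<close>.\<close>
  define \<phi>\<^sub>0 where "\<phi>\<^sub>0 = Ex 0 (Conj (Equal (Var 0) (Param x\<^sub>0)) \<phi>')"
  define \<psi>' where "\<psi>' b = Ex 0 (Conj (Equal (Var 0) (Var (y b))) (\<psi> b))" for b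
  define \<chi> where "\<chi> = Conj (Neg (Conj \<phi>' \<phi>\<^sub>0)) (Neg (Conj (Neg \<phi>') (Neg \<phi>\<^sub>0)))"
  define \<theta> where "\<theta> = Neg (foldr Ex (map y bs) (foldr Conj (map \<psi>' bs) \<chi>))"
  have dom_i: "dom i = B" and ran_i: "(\<lambda>k. 2 * k + 1) ` ran i = y ` B"
    by (auto simp: i_def y_def dom_def ran_def)
  have "wf_formula L A \<phi>'"
    using \<phi> by (simp add: \<phi>'_def wf_abs_formula dom_i formulas1_def)
  moreover have "fv \<phi>' \<subseteq> {0} \<union> y ` B"
    using \<phi> fv_abs_formula[of i \<phi>] unfolding \<phi>'_def formulas1_def ran_i by fastforce
  moreover have "wf_formula L A (\<psi>' b)" "fv (\<psi>' b) \<subseteq> {y b}" if "b \<in> B" for b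
    using \<psi>[OF that] by (auto simp: \<psi>'_def formulas1_def)
  ultimately have "\<theta> \<in> formulas1 L A"
    using \<open>x\<^sub>0 \<in> A\<close>
    by (fastforce simp: \<theta>_def \<chi>_def \<phi>\<^sub>0_def formulas1_def wf_foldr_Ex fv_foldr_Ex
        wf_foldr_Conj fv_foldr_Conj bs)
  moreover have "holds_at K \<theta> x \<longleftrightarrow> (\<forall>h. admissible K B \<psi> h \<longrightarrow>
        (holds_at K (map_params h \<phi>) x \<longleftrightarrow> holds_at K (map_params h \<phi>) x\<^sub>0))"
    if K: "A \<subseteq> univ K" "x \<in> univ K" for K x
  proof -
    have sat_\<phi>': "sat K w \<phi>' \<longleftrightarrow> holds_at K (map_params (abs_inst i w) \<phi>) (w 0)" for w
    proof -
      have "fv (map_params (abs_inst i w) \<phi>) \<subseteq> {0}"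
        using \<phi> by (simp add: fv_map_params formulas1_def)
      then show ?thesis
        unfolding \<phi>'_def sat_abs_formula holds_at_def by (intro sat_cong) auto
    qed
    have inst_upd: "abs_inst i (w(0 := a)) = abs_inst i w" for w a
      by (auto simp: abs_inst_def fun_eq_iff split: option.split)
    have "x\<^sub>0 \<in> univ K" using K \<open>x\<^sub>0 \<in> A\<close> by auto
    then have sat_\<phi>\<^sub>0: "sat K w \<phi>\<^sub>0 \<longleftrightarrow> holds_at K (map_params (abs_inst i w) \<phi>) x\<^sub>0" for w
      by (auto simp: \<phi>\<^sub>0_def sat_\<phi>' inst_upd)
    have sat_\<psi>': "sat K w (\<psi>' b) \<longleftrightarrow> holds_at K (\<psi> b) (w (y b))"
      if "b \<in> B" "w (y b) \<in> univ K" for w b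
      using that by (auto simp: \<psi>'_def sat_formulas1[OF \<psi>] y_def)
    have inst: "abs_inst i w b = w (y b)" if "b \<in> B" for w b
      using that by (simp add: abs_inst_def i_def y_def)
    have inst': "abs_inst i w a = a" if "a \<notin> B" for w a
      using that by (simp add: abs_inst_def i_def)
    let ?D = "\<lambda>h. holds_at K (map_params h \<phi>) x \<noteq> holds_at K (map_params h \<phi>) x\<^sub>0"
    \<comment> \<open>A valuation equal to \<open>x\<close> off the variables \<open>y b\<close>
      holds exactly the data of a counterexample: the point \<open>x\<close> at index 0 and a tuple
      at the indices \<open>y b\<close>.\<close>
    have witness: "(\<forall>n\<in>y ` B. w n \<in> univ K) \<and> (\<forall>b\<in>B. sat K w (\<psi>' b)) \<and> sat K w \<chi> \<longleftrightarrow>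
          admissible K B \<psi> (abs_inst i w) \<and> ?D (abs_inst i w)"
      if w: "\<forall>n. n \<notin> y ` B \<longrightarrow> w n = x" for w
    proof -
      have "0 \<notin> y ` B" by (auto simp: y_def)
      then have "w 0 = x" using w by blast
      then have "sat K w \<chi> \<longleftrightarrow> ?D (abs_inst i w)"
        by (auto simp: \<chi>_def sat_\<phi>' sat_\<phi>\<^sub>0)
      moreover have "(\<forall>n\<in>y ` B. w n \<in> univ K) \<and> (\<forall>b\<in>B. sat K w (\<psi>' b))
          \<longleftrightarrow> admissible K B \<psi> (abs_inst i w)"
        by (auto simp: admissible_def inst inst' defset_def sat_\<psi>')
      ultimately show ?thesis by blast
    qed
    have "\<not> holds_at K \<theta> x \<longleftrightarrow>
      (\<exists>w. (\<forall>n. n \<notin> y ` B \<longrightarrow> w n = x) \<and> (\<forall>n\<in>y ` B. w n \<in> univ K) \<and>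
        (\<forall>b\<in>B. sat K w (\<psi>' b)) \<and> sat K w \<chi>)"
      by (simp only: holds_at_def \<theta>_def sat.simps sat_foldr_Ex sat_foldr_Conj set_map bs
          ball_simps not_not)
    also have "\<dots> \<longleftrightarrow> (\<exists>w. (\<forall>n. n \<notin> y ` B \<longrightarrow> w n = x) \<and>
        admissible K B \<psi> (abs_inst i w) \<and> ?D (abs_inst i w))"
      using witness by blast
    also have "\<dots> \<longleftrightarrow> (\<exists>h. admissible K B \<psi> h \<and> ?D h)"
    proof
      assume "\<exists>h. admissible K B \<psi> h \<and> ?D h"
      then obtain h where h: "admissible K B \<psi> h" "?D h" by blast
      \<comment> \<open>Conversely, \<open>h\<close> is stored in the odd variables, which is
        consistent because \<open>y\<close> is injective on \<open>B\<close>. Outside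
        \<open>B\<close> nothing is lost, as an admissible \<open>h\<close> is the identity
        there.\<close>
      define w where "w n = (if n \<in> y ` B then h (inv_into B y n) else x)" for n
      have "inj_on y B" using y_inj by (auto intro: inj_onI)
      then have "w (y b) = h b" if "b \<in> B" for b using that by (simp add: w_def)
      then have "abs_inst i w = h"
        using h(1) inst inst' by (metis admissible_def ext)
      then show "\<exists>w. (\<forall>n. n \<notin> y ` B \<longrightarrow> w n = x) \<and>
          admissible K B \<psi> (abs_inst i w) \<and> ?D (abs_inst i w)"
        using h by (intro exI[of _ w]) (auto simp: w_def)
    qed blast
    finally show ?thesis by blast
  qed
  ultimately show ?thesis by (rule that)
qed

section \<open>The generic type\<close>

lemma complete_types_satisfiable:
  "p \<in> complete_types L N A \<Longrightarrow> finite F \<Longrightarrow> F \<subseteq> p \<Longrightarrow> \<exists>a\<in>univ N. \<forall>\<phi>\<in>F. holds_at N \<phi> a"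
  by (simp add: complete_types_def)

text \<open>The extension consists of the formulas implied in \<open>N\<close> by single members of
  \<open>p\<close>; finite satisfiability is inherited from \<open>p\<close>. A type containing
  \<open>p\<close> cannot contain a formula refuted by a member of \<open>p\<close>, so completeness
  leaves no other choice.\<close>

lemma complete_type_unique_extension:
  assumes p: "p \<in> complete_types L N A" and "A \<subseteq> C"
    and decide: "\<And>\<phi>. \<phi> \<in> formulas1 L C \<Longrightarrow> \<exists>\<theta>\<in>p.
      (\<forall>a\<in>univ N. holds_at N \<theta> a \<longrightarrow> holds_at N \<phi> a) \<or>
      (\<forall>a\<in>univ N. holds_at N \<theta> a \<longrightarrow> \<not> holds_at N \<phi> a)"
  shows "\<exists>!q. q \<in> complete_types L N C \<and> p \<subseteq> q"
proof -
  define q where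
    "q = {\<phi> \<in> formulas1 L C. \<exists>\<theta>\<in>p. \<forall>a\<in>univ N. holds_at N \<theta> a \<longrightarrow> holds_at N \<phi> a}"
  have "\<exists>a\<in>univ N. \<forall>\<phi>\<in>F. holds_at N \<phi> a" if F: "finite F" "F \<subseteq> q" for F
  proof -
    have "\<forall>\<phi>\<in>F. \<exists>\<theta>\<in>p. \<forall>a\<in>univ N. holds_at N \<theta> a \<longrightarrow> holds_at N \<phi> a"
      using F(2) by (auto simp: q_def)
    then obtain t where t: "\<forall>\<phi>\<in>F. t \<phi> \<in> p \<and> (\<forall>a\<in>univ N. holds_at N (t \<phi>) a \<longrightarrow> holds_at N \<phi> a)"
      by metis
    then obtain a where "a \<in> univ N" "\<forall>\<theta>\<in>t ` F. holds_at N \<theta> a"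
      using complete_types_satisfiable[OF p, of "t ` F"] F(1) by blast
    then show ?thesis using t by blast
  qed
  moreover have q_complete: "\<phi> \<in> q \<or> Neg \<phi> \<in> q" if "\<phi> \<in> formulas1 L C" for \<phi>
    using decide[OF that] that formulas1_Neg[OF that] by (auto simp: q_def holds_at_def)
  ultimately have "q \<in> complete_types L N C"
    by (auto simp: complete_types_def q_def)
  moreover have "p \<subseteq> q"
    using p formulas1_mono[OF \<open>A \<subseteq> C\<close>, of L] by (auto simp: complete_types_def q_def)
  moreover have "r = q" if r: "r \<in> complete_types L N C" "p \<subseteq> r" for r
  proof -
    have clash: False if "\<phi> \<in> r" "\<theta> \<in> p" "\<forall>a\<in>univ N. holds_at N \<theta> a \<longrightarrow> \<not> holds_at N \<phi> a" for \<phi> \<theta>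
    proof -
      have "\<exists>a\<in>univ N. \<forall>\<phi>'\<in>{\<phi>, \<theta>}. holds_at N \<phi>' a"
        using r that(1,2) by (intro complete_types_satisfiable) auto
      then show False using that(3) by blast
    qed
    show ?thesis
    proof (intro set_eqI iffI)
      fix \<phi> assume "\<phi> \<in> r"
      then have "\<phi> \<in> formulas1 L C" using r by (auto simp: complete_types_def)
      moreover have "Neg \<phi> \<notin> q"
        using clash[OF \<open>\<phi> \<in> r\<close>] by (auto simp: q_def holds_at_def)
      ultimately show "\<phi> \<in> q" using q_complete by blast
    next
      fix \<phi> assume "\<phi> \<in> q"
      then have "\<phi> \<in> formulas1 L C" by (simp add: q_def)
      moreover have "Neg \<phi> \<notin> r"
        using clash[of "Neg \<phi>"] \<open>\<phi> \<in> q\<close> by (auto simp: q_def holds_at_def)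
      ultimately show "\<phi> \<in> r" using r by (auto simp: complete_types_def)
    qed
  qed
  ultimately show ?thesis by blast
qed

section \<open>The generic type is complete and not isolated\<close>

lemma defset_Neg: "defset K (Neg \<phi>) = univ K - defset K \<phi>"
  by (auto simp: defset_def holds_at_def)

lemma type_of_element_complete:
  "a \<in> univ N \<Longrightarrow> {\<phi> \<in> formulas1 L A. holds_at N \<phi> a} \<in> complete_types L N A"
  by (auto simp: complete_types_def formulas1_Neg holds_at_def)

text \<open>Finitely many co-countable sets have a common point because \<open>M\<close> is
  uncountable, and that point still works in \<open>N\<close> by elementarity. Completeness is the
  dichotomy of quasiminimality.\<close>

lemma generic_type_complete:
  assumes "quasiminimal L M" "elementary_extension L M N"
  shows "generic_type L M \<in> complete_types L N (univ M)"
proof -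
  have MN: "univ M \<subseteq> univ N"
    using assms(2) by (simp add: elementary_extension_def substructure_def)
  have "\<exists>a\<in>univ N. \<forall>\<phi>\<in>F. holds_at N \<phi> a" if F: "finite F" "F \<subseteq> generic_type L M" for F
  proof -
    have "countable (\<Union>\<phi>\<in>F. univ M - defset M \<phi>)"
      using F by (intro countable_UN) (auto simp: generic_type_def countable_finite)
    then have "\<not> univ M \<subseteq> (\<Union>\<phi>\<in>F. univ M - defset M \<phi>)"
      using assms(1) countable_subset by (auto simp: quasiminimal_def)
    then obtain a where a: "a \<in> univ M" "\<forall>\<phi>\<in>F. holds_at M \<phi> a"
      by (auto simp: defset_def)
    then have "\<forall>\<phi>\<in>F. holds_at N \<phi> a"
      using F(2) elementary_extension_holds_at[OF assms(2)] by (auto simp: generic_type_def)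
    then show ?thesis using a MN by blast
  qed
  moreover have "\<phi> \<in> generic_type L M \<or> Neg \<phi> \<in> generic_type L M"
    if "\<phi> \<in> formulas1 L (univ M)" for \<phi>
  proof -
    have "univ M - (univ M - defset M \<phi>) = defset M \<phi>" by (auto simp: defset_def)
    then show ?thesis
      using assms(1) that formulas1_Neg[OF that]
      by (auto simp: quasiminimal_def generic_type_def defset_Neg)
  qed
  ultimately show ?thesis
    by (auto simp: complete_types_def generic_type_def)
qed

text \<open>An isolating formula would have a co-countable, hence nonempty, solution set in
  \<open>M\<close>. The type over \<open>M\<close> of a solution \<open>a\<close> would then be the
  generic type, which contains the formula saying that \<open>x\<close> differs from
  \<open>a\<close>.\<close>

lemma generic_type_not_isolated:
  assumes "quasiminimal L M" "elementary_extension L M N"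
  shows "\<not> isolated_type L N (univ M) (generic_type L M)"
proof
  assume "isolated_type L N (univ M) (generic_type L M)"
  then obtain \<phi> where \<phi>: "\<phi> \<in> formulas1 L (univ M)"
    and iso: "{q \<in> complete_types L N (univ M). \<phi> \<in> q} = {generic_type L M}"
    by (auto simp: isolated_type_def)
  have "\<phi> \<in> generic_type L M" using iso by blast
  then have "defset M \<phi> \<noteq> {}"
    using assms(1) by (auto simp: generic_type_def quasiminimal_def)
  then obtain a where a: "a \<in> univ M" "holds_at M \<phi> a" by (auto simp: defset_def)
  define q where "q = {\<chi> \<in> formulas1 L (univ M). holds_at N \<chi> a}"
  have "a \<in> univ N"
    using a assms(2) by (auto simp: elementary_extension_def substructure_def)
  then have "q \<in> complete_types L N (univ M)"
    unfolding q_def by (rule type_of_element_complete)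
  moreover have "\<phi> \<in> q"
    using \<phi> a elementary_extension_holds_at[OF assms(2)] by (simp add: q_def)
  ultimately have "q = generic_type L M" using iso by blast
  moreover have "Neg (Equal (Var 0) (Param a)) \<in> generic_type L M"
  proof -
    have "univ M - defset M (Neg (Equal (Var 0) (Param a))) = {a}"
      using a by (auto simp: defset_def holds_at_def)
    then show ?thesis using a by (simp add: generic_type_def formulas1_def)
  qed
  ultimately have "Neg (Equal (Var 0) (Param a)) \<in> q" by simp
  then show False by (simp add: q_def holds_at_def)
qed

section \<open>The generic type decides every formula over \<open>M\<close> and the tuple\<close>

text \<open>An admissible \<open>h\<close> is determined by the finite list of its values on
  \<open>B\<close>, and these values come from a countable set.\<close>

lemma countable_admissible:
  assumes "finite B" "\<And>b. b \<in> B \<Longrightarrow> countable (defset K (\<psi> b))"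
  shows "countable {h. admissible K B \<psi> h}"
proof -
  obtain bs where bs: "set bs = B" using finite_list[OF assms(1)] by blast
  have "inj_on (\<lambda>h. map h bs) {h. admissible K B \<psi> h}"
    by (rule inj_onI, rule ext) (metis admissible_def bs map_eq_conv mem_Collect_eq)
  moreover have "(\<lambda>h. map h bs) ` {h. admissible K B \<psi> h} \<subseteq> lists (\<Union>b\<in>B. defset K (\<psi> b))"
    by (fastforce simp: admissible_def bs)
  moreover have "countable (lists (\<Union>b\<in>B. defset K (\<psi> b)))"
    using assms by (intro countable_lists countable_UN) (auto intro: countable_finite)
  ultimately show ?thesis by (meson countable_image_inj_on countable_subset)
qed

lemma generic_type_decides:
  assumes qm: "quasiminimal L M" and ext: "elementary_extension L M N"
    and B: "finite B" "B \<subseteq> univ N" "\<And>b. b \<in> B \<Longrightarrow> \<not> realizes N b (generic_type L M)"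
    and \<phi>: "\<phi> \<in> formulas1 L (univ M \<union> B)"
  shows "\<exists>\<theta>\<in>generic_type L M.
      (\<forall>a\<in>univ N. holds_at N \<theta> a \<longrightarrow> holds_at N \<phi> a) \<or>
      (\<forall>a\<in>univ N. holds_at N \<theta> a \<longrightarrow> \<not> holds_at N \<phi> a)"
proof -
  have MN: "univ M \<subseteq> univ N"
    using ext by (simp add: elementary_extension_def substructure_def)
  have "\<forall>b\<in>B. \<exists>\<chi>\<in>generic_type L M. \<not> holds_at N \<chi> b"
    using B by (auto simp: realizes_def)
  then obtain g where g: "\<And>b. b \<in> B \<Longrightarrow> g b \<in> generic_type L M \<and> \<not> holds_at N (g b) b"
    by metis
  \<comment> \<open>Since \<open>g b\<close> is co-countable in \<open>M\<close> and fails at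
    \<open>b\<close>, its negation holds at \<open>b\<close> and has only countably many solutions
    in \<open>M\<close>. The condition on the tuple is thus imposed entry by entry.\<close>
  define \<psi> where "\<psi> b = Neg (g b)" for b
  have \<psi>: "\<psi> b \<in> formulas1 L (univ M)" and \<psi>_countable: "countable (defset M (\<psi> b))"
    if "b \<in> B" for b
    using g[OF that] by (auto simp: \<psi>_def generic_type_def formulas1_Neg defset_Neg)
  define H where "H = {h. admissible M B \<psi> h}"
  have "countable H"
    unfolding H_def using B(1) \<psi>_countable by (rule countable_admissible)
  \<comment> \<open>Replacing the tuple by values in \<open>M\<close> gives a formula over
    \<open>M\<close>, to which quasiminimality applies.\<close>
  have H_formulas: "map_params h \<phi> \<in> formulas1 L (univ M)" if "h \<in> H" for h
  proof -
    have "univ M \<union> B \<subseteq> h -` univ M"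
      using that by (fastforce simp: H_def admissible_def defset_def)
    then show ?thesis
      using \<phi> wf_formula_mono[of L "univ M \<union> B" \<phi> "h -` univ M"]
      by (simp add: formulas1_def wf_map_params fv_map_params)
  qed
  define S where "S h = (if countable (defset M (map_params h \<phi>))
      then defset M (map_params h \<phi>) else univ M - defset M (map_params h \<phi>))" for h
  have "countable (S h)" if "h \<in> H" for h
    using qm H_formulas[OF that] by (auto simp: S_def quasiminimal_def)
  then have S_countable: "countable (\<Union>h\<in>H. S h)" using \<open>countable H\<close> by blast
  then have "\<not> univ M \<subseteq> (\<Union>h\<in>H. S h)"
    using qm countable_subset by (auto simp: quasiminimal_def)
  then obtain x\<^sub>0 where x\<^sub>0: "x\<^sub>0 \<in> univ M" "x\<^sub>0 \<notin> (\<Union>h\<in>H. S h)" by blast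
  obtain \<theta> where \<theta>: "\<theta> \<in> formulas1 L (univ M)"
    and \<theta>_iff: "\<And>K x. univ M \<subseteq> univ K \<Longrightarrow> x \<in> univ K \<Longrightarrow> holds_at K \<theta> x \<longleftrightarrow>
      (\<forall>h. admissible K B \<psi> h \<longrightarrow>
        (holds_at K (map_params h \<phi>) x \<longleftrightarrow> holds_at K (map_params h \<phi>) x\<^sub>0))"
    by (rule agreement_formula[OF \<phi> B(1) \<psi> x\<^sub>0(1)]) blast+
  \<comment> \<open>Off the discarded set, the truth value depends on \<open>h\<close> alone. Hence
    any two remaining points agree for every admissible \<open>h\<close>.\<close>
  have off_S: "holds_at M (map_params h \<phi>) x \<longleftrightarrow> uncountable (defset M (map_params h \<phi>))"
    if "x \<in> univ M" "x \<notin> (\<Union>h\<in>H. S h)" "h \<in> H" for x h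
    using that by (fastforce simp: S_def defset_def split: if_splits)
  have "univ M - defset M \<theta> \<subseteq> (\<Union>h\<in>H. S h)"
  proof (rule subsetI, rule ccontr)
    fix x assume x: "x \<in> univ M - defset M \<theta>" "x \<notin> (\<Union>h\<in>H. S h)"
    then have "holds_at M \<theta> x"
      using \<theta>_iff[of M x] off_S[of x] off_S[OF x\<^sub>0] by (auto simp: H_def)
    then show False using x by (simp add: defset_def)
  qed
  then have "\<theta> \<in> generic_type L M"
    using \<theta> S_countable countable_subset by (auto simp: generic_type_def)
  moreover have "holds_at N \<phi> x \<longleftrightarrow> holds_at N \<phi> x\<^sub>0" if "x \<in> univ N" "holds_at N \<theta> x" for x
  proof -
    \<comment> \<open>In \<open>N\<close> the original tuple is itself admissible, so
      \<open>\<theta>\<close> forces agreement with \<open>x\<^sub>0\<close> on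
      \<open>\<phi>\<close> itself. The truth value of \<open>\<phi>\<close> at
      \<open>x\<^sub>0\<close> then selects the disjunct.\<close>
    have "admissible N B \<psi> id"
      using B(2) g by (auto simp: admissible_def defset_def \<psi>_def holds_at_def)
    then show ?thesis
      using \<theta>_iff[OF MN that(1)] that(2) map_params_idI[of \<phi> id] by fastforce
  qed
  ultimately show ?thesis by blast
qed

theorem corollary3:
  fixes L :: "('f, 'r) language" and M N :: "('f, 'r, 'a) fo_structure"
  assumes "quasiminimal L M"
    and "elementary_extension L M N"
    and "saturated L N"
  shows "locally_strongly_regular L N (univ M) (generic_type L M) (Equal (Var 0) (Var 0))"
proof -
  have "Equal (Var 0) (Var 0) \<in> generic_type L M"
    by (simp add: generic_type_def formulas1_def defset_def holds_at_def)
  moreover have "\<exists>!q. q \<in> complete_types L N (univ M \<union> set bs) \<and> generic_type L M \<subseteq> q"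
    if "set bs \<subseteq> univ N" "\<forall>b\<in>set bs. \<not> realizes N b (generic_type L M)" for bs
    using generic_type_complete[OF assms(1,2)] that
    by (intro complete_type_unique_extension generic_type_decides[OF assms(1,2)]) auto
  ultimately show ?thesis
    using generic_type_complete[OF assms(1,2)] generic_type_not_isolated[OF assms(1,2)]
    by (simp add: locally_strongly_regular_def)
qed

end
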